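(* If $G \ne K_4$ is a connected, claw-free, subcubic graph, then \[\operatorname{Z}(G) \le \alpha(G) + 1.\]
   Context: All graphs are simple, finite and undirected. A graph is subcubic if it has maximum degree at most $3$. A claw is the graph $K_{1,3}$; a graph is claw-free if it does not contain a claw as an induced subgraph. $\alpha(G)$ is the independence number of $G$. Zero forcing: given a set $B\subseteq V(G)$ of initially blue vertices (the rest white), if a blue vertex has exactly one white neighbor $w$, it can force $w$ to become blue; this rule is applied repeatedly. $B$ is a zero forcing set if all vertices can eventually become blue. $\operatorname{Z}(G)$ is the minimum cardinality of a zero forcing set of $G$. *)

theory Defs
  imports "Graph_Theory.Graph_Theory"
begin

text \<open>
  Simple finite undirected graphs are the symmetric loop-free finite digraphs of locale
  \<^locale>\<open>pair_graph\<close>: an edge \<open>uv\<close> is the pair of arcs \<open>(u,v)\<close>, \<open>(v,u)\<close>, so the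
  out-degree of a vertex is its degree.
\<close>

definition subcubic :: "('a,'b) pre_digraph \<Rightarrow> bool" where
  "subcubic G \<longleftrightarrow> (\<forall>v \<in> verts G. out_degree G v \<le> 3)"

definition claw_free :: "('a,'b) pre_digraph \<Rightarrow> bool" where
  "claw_free G \<longleftrightarrow> \<not> (\<exists>H. induced_subgraph H G \<and> complete_bipartite_digraph 1 3 H)"

definition independent_set :: "('a,'b) pre_digraph \<Rightarrow> 'a set \<Rightarrow> bool" where
  "independent_set G S \<longleftrightarrow> S \<subseteq> verts G \<and> (\<forall>u \<in> S. \<forall>v \<in> S. \<not> u \<rightarrow>\<^bsub>G\<^esub> v)"

definition independence_number :: "('a,'b) pre_digraph \<Rightarrow> nat" where
  "independence_number G = Max {card S | S. independent_set G S}"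

inductive force_step :: "('a,'b) pre_digraph \<Rightarrow> 'a set \<Rightarrow> 'a set \<Rightarrow> bool" for G where
  force: "v \<in> B \<Longrightarrow> {x \<in> verts G - B. v \<rightarrow>\<^bsub>G\<^esub> x} = {w} \<Longrightarrow> force_step G B (insert w B)"

definition zero_forcing_set :: "('a,'b) pre_digraph \<Rightarrow> 'a set \<Rightarrow> bool" where
  "zero_forcing_set G B \<longleftrightarrow> B \<subseteq> verts G \<and> (force_step G)\<^sup>*\<^sup>* B (verts G)"

definition zero_forcing_number :: "('a,'b) pre_digraph \<Rightarrow> nat" where
  "zero_forcing_number G = Min {card B | B. zero_forcing_set G B}"

end

theory Submission
  imports Defs
begin

text \<open>
  The proof is a greedy one: a blue set and an independent set \<open>I\<close> grow together, so that each
  newly coloured vertex is paid for by a new vertex of \<open>I\<close>. The blue set always has the form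
  \<open>N[J]\<close>, the closed neighbourhood of a set \<open>J\<close> that contains \<open>I\<close>
  (predicate \<open>grown\<close>). Hence a white vertex is never adjacent to \<open>I\<close>, and any white vertex
  may be put into \<open>I\<close>. Moreover a blue vertex \<open>v\<close> with white neighbours lies outside
  \<open>J\<close>, so it has a neighbour \<open>u\<close> in \<open>J\<close>. As the degree is at most 3, \<open>v\<close> has at most
  two white neighbours. If it has just one, a force is available for free. If it has two,
  \<open>a\<close> and \<open>b\<close>, then all neighbours of \<open>u\<close> are blue and claw-freeness at \<open>v\<close> makes
  \<open>a\<close> and \<open>b\<close> adjacent. Colouring \<open>a\<close> makes \<open>v\<close> force \<open>b\<close>, and then \<open>a\<close> has at
  most one white neighbour and forces it: \<open>v\<close> and \<open>a\<close> enter \<open>J\<close>, and \<open>a\<close> enters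
  \<open>I\<close>. By connectedness this ends only when all vertices are blue (\<open>grown_complete\<close>), and the
  difference between the number of coloured vertices and the size of \<open>I\<close> has not increased.

  It remains to start with a difference of at most 1. A vertex of degree at most 2, coloured
  together with one neighbour, forces its other neighbour: 2 against 1. In a diamond with
  nonadjacent tips \<open>p\<close> and \<open>q\<close>, the set \<open>J = I = {p, q}\<close> costs 3; two common neighbours
  of adjacent vertices are nonadjacent precisely because the graph is not \<open>K\<^sub>4\<close>. If neither
  exists, the graph is cubic, every vertex lies in a triangle, and no edge lies in two
  triangles. Starting from a vertex gives only 3 against 1, but here the last step of the
  process yields one more independent vertex (\<open>grown_complete_gain\<close>), since the
  last white part holds a vertex that joins \<open>I\<close> for free, or two nonadjacent ones for the
  price of one.
\<close>

section \<open>Forcing\<close>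

context pair_graph
begin

definition nbrs :: "'a \<Rightarrow> 'a set" where
  "nbrs v = {w. (v, w) \<in> parcs G}"

definition closed_nbrs :: "'a set \<Rightarrow> 'a set" where
  "closed_nbrs J = J \<union> (\<Union>v\<in>J. nbrs v)"

abbreviation forces :: "'a set \<Rightarrow> 'a set \<Rightarrow> bool" where
  "forces \<equiv> (force_step (with_proj G))\<^sup>*\<^sup>*"

lemma nbrs_subset: "nbrs v \<subseteq> pverts G"
  unfolding nbrs_def using in_arcsD2 by auto

lemma finite_nbrs[simp]: "finite (nbrs v)"
  using nbrs_subset pair_finite_verts finite_subset by blast

lemma nbrs_sym: "w \<in> nbrs v \<longleftrightarrow> v \<in> nbrs w"
  unfolding nbrs_def using arcs_ends_symmetric[of "with_proj G"] pair_sym_arcs by auto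

lemma not_self_nbr[simp]: "v \<notin> nbrs v"
  unfolding nbrs_def using no_loops' by blast

lemma closed_nbrs_subset: "J \<subseteq> pverts G \<Longrightarrow> closed_nbrs J \<subseteq> pverts G"
  unfolding closed_nbrs_def using nbrs_subset by blast

lemma closed_nbrs_insert:
  "v \<in> closed_nbrs J \<Longrightarrow> closed_nbrs (insert v J) = closed_nbrs J \<union> nbrs v"
  unfolding closed_nbrs_def by blast

lemma independent_set_iff:
  "independent_set (with_proj G) I \<longleftrightarrow> I \<subseteq> pverts G \<and> (\<forall>u\<in>I. nbrs u \<inter> I = {})"
  unfolding independent_set_def nbrs_def by auto

lemma independent_set_insert:
  assumes "independent_set (with_proj G) I" "w \<in> pverts G" "nbrs w \<inter> I = {}"
  shows "independent_set (with_proj G) (insert w I)"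
  using assms nbrs_sym unfolding independent_set_iff by auto

text \<open>
  This form of the colour change rule covers the case that there is nothing left to force, so
  that later steps need not distinguish whether the last neighbour is already blue or exists.
\<close>

lemma forces_nbrs:
  assumes "v \<in> S" "card (nbrs v - S) \<le> 1"
  shows "forces S (S \<union> nbrs v)"
proof (cases "nbrs v \<subseteq> S")
  case True
  then show ?thesis by (simp add: Un_absorb2)
next
  case False
  then have "card (nbrs v - S) = 1"
    using assms(2) by (metis Diff_eq_empty_iff One_nat_def card_0_eq finite_Diff finite_nbrs
      le_SucE le_zero_eq)
  then obtain w where w: "nbrs v - S = {w}"
    by (rule card_1_singletonE)
  then have "{x \<in> verts (with_proj G) - S. v \<rightarrow>\<^bsub>with_proj G\<^esub> x} = {w}"
    using nbrs_subset[of v] unfolding nbrs_def by auto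
  then have "force_step (with_proj G) S (insert w S)"
    using assms(1) force_step.force by metis
  moreover have "insert w S = S \<union> nbrs v"
    using w by blast
  ultimately show ?thesis by auto
qed

text \<open>
  An extra blue vertex can only spoil a force by already being its target.
\<close>

lemma forces_insert:
  assumes "forces B S"
  shows "forces (insert a B) (insert a S)"
  using assms
proof (induction rule: rtranclp_induct)
  case base
  show ?case by simp
next
  case (step S T)
  from step.hyps(2) obtain v w where v: "v \<in> S" and T: "T = insert w S"
    and w: "{x \<in> verts (with_proj G) - S. v \<rightarrow>\<^bsub>with_proj G\<^esub> x} = {w}"
    by (auto elim: force_step.cases)
  show ?case
  proof (cases "w = a")
    case True
    then show ?thesis using step.IH T by simp
  next
    case False
    then have "{x \<in> verts (with_proj G) - insert a S. v \<rightarrow>\<^bsub>with_proj G\<^esub> x} = {w}"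
      using w by blast
    then have "force_step (with_proj G) (insert a S) (insert w (insert a S))"
      using v force_step.force by (metis insertI2)
    then show ?thesis
      using step.IH T by (simp add: insert_commute)
  qed
qed

lemma forces_all_bound:
  assumes "B \<subseteq> pverts G" "forces B (pverts G)"
    and "independent_set (with_proj G) I" "card B \<le> card I + 1"
  shows "zero_forcing_number (with_proj G) \<le> independence_number (with_proj G) + 1"
proof -
  have "finite {card B |B. zero_forcing_set (with_proj G) B}"
    by (rule finite_subset[of _ "card ` Pow (pverts G)"])
       (auto simp: zero_forcing_set_def pair_finite_verts)
  then have "zero_forcing_number (with_proj G) \<le> card B"
    unfolding zero_forcing_number_def using assms(1,2)
    by (intro Min_le) (auto simp: zero_forcing_set_def)
  moreover have "finite {card S |S. independent_set (with_proj G) S}"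
    by (rule finite_subset[of _ "card ` Pow (pverts G)"])
       (auto simp: independent_set_def pair_finite_verts)
  then have "card I \<le> independence_number (with_proj G)"
    unfolding independence_number_def using assms(3)
    by (intro Max_ge) auto
  ultimately show ?thesis using assms(4) by linarith
qed

lemma boundary_edge:
  assumes "Digraph_Component.connected (with_proj G)"
    and "S \<noteq> {}" "S \<subset> pverts G"
  obtains v w where "v \<in> S" "w \<in> nbrs v" "w \<notin> S"
proof -
  have sc: "strongly_connected (with_proj G)"
    using assms(1) pair_sym_arcs symmetric_connected_imp_strongly_connected by blast
  obtain s t where s: "s \<in> S" and t: "t \<in> pverts G" "t \<notin> S"
    using assms(2,3) by blast
  have "s \<rightarrow>\<^sup>*\<^bsub>with_proj G\<^esub> t"
    using sc s t assms(3) unfolding strongly_connected_def by auto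
  then have "(s, t) \<in> rtrancl_on (pverts G) (parcs G)"
    by (simp add: reachable_def)
  then have "t \<in> S \<or> (\<exists>v\<in>S. \<exists>w. w \<in> nbrs v \<and> w \<notin> S)"
    by (induction rule: rtrancl_on_induct) (use s in \<open>auto simp: nbrs_def\<close>)
  then show ?thesis using t that by blast
qed

text \<open>
  Three pairwise nonadjacent neighbours of \<open>v\<close> would form an induced \<open>K\<^bsub>1,3\<^esub>\<close> with centre
  \<open>v\<close>. The condition on the cardinality says that \<open>x\<close>, \<open>y\<close>, \<open>z\<close> are distinct.
\<close>

lemma claw_free_nbrs:
  assumes "claw_free (with_proj G)"
    and "{x, y, z} \<subseteq> nbrs v" "card {x, y, z} = 3"
  shows "y \<in> nbrs x \<or> z \<in> nbrs x \<or> z \<in> nbrs y"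
proof (rule ccontr)
  assume no: "\<not> ?thesis"
  let ?W = "{x, y, z}"
  define H where "H = \<lparr>pverts = insert v ?W, parcs = {v} \<times> ?W \<union> ?W \<times> {v}\<rparr>"
  have vW: "v \<notin> ?W"
    using assms(2) not_self_nbr by blast
  have nb: "nbrs x \<inter> ?W = {}" "nbrs y \<inter> ?W = {}" "nbrs z \<inter> ?W = {}"
    using no nbrs_sym not_self_nbr by blast+
  have V: "insert v ?W \<subseteq> pverts G"
    using assms(2) nbrs_subset nbrs_sym by blast
  have arcs: "{v} \<times> ?W \<union> ?W \<times> {v} = {e \<in> parcs G. fst e \<in> insert v ?W \<and> snd e \<in> insert v ?W}"
  proof (intro equalityI subsetI)
    fix e
    assume "e \<in> {v} \<times> ?W \<union> ?W \<times> {v}"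
    then show "e \<in> {e \<in> parcs G. fst e \<in> insert v ?W \<and> snd e \<in> insert v ?W}"
      using assms(2) nbrs_sym[of _ v] unfolding nbrs_def by auto
  next
    fix e
    assume e: "e \<in> {e \<in> parcs G. fst e \<in> insert v ?W \<and> snd e \<in> insert v ?W}"
    obtain p q where pq: "e = (p, q)" by force
    have q: "q \<in> nbrs p" "p \<in> insert v ?W" "q \<in> insert v ?W"
      using e pq unfolding nbrs_def by auto
    have "p = v \<and> q \<in> ?W \<or> p \<in> ?W \<and> q = v"
      using q nb not_self_nbr by blast
    then show "e \<in> {v} \<times> ?W \<union> ?W \<times> {v}"
      using pq by blast
  qed
  have "complete_bipartite_digraph 1 3 (with_proj H)"
    unfolding complete_bipartite_digraph_pair_def
    using vW assms(3) by (intro conjI exI[of _ "{v}"] exI[of _ ?W]) (auto simp: H_def)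
  moreover from this have "wf_digraph (with_proj H)"
    unfolding complete_bipartite_digraph_def graph_def digraph_def fin_digraph_def by blast
  then have "induced_subgraph (with_proj H) (with_proj G)"
    unfolding induced_subgraph_def subgraph_def
    using V arcs wf_digraph by (auto simp: H_def)
  ultimately show False
    using assms(1) unfolding claw_free_def by blast
qed

lemma subcubic_card_nbrs:
  assumes "subcubic (with_proj G)"
  shows "card (nbrs v) \<le> 3"
proof (cases "v \<in> pverts G")
  case True
  have "out_arcs (with_proj G) v = Pair v ` nbrs v"
    unfolding out_arcs_def nbrs_def by auto
  then have "card (nbrs v) = out_degree (with_proj G) v"
    unfolding out_degree_def by (simp add: card_image inj_on_def)
  then show ?thesis
    using assms True unfolding subcubic_def by simp
next
  case False
  then have "nbrs v = {}"
    unfolding nbrs_def using in_arcsD1 by auto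
  then show ?thesis by simp
qed

end

section \<open>Growing a forced neighbourhood together with an independent set\<close>

locale claw_free_subcubic_graph = pair_graph G for G :: "'a pair_pre_digraph" +
  assumes connected: "Digraph_Component.connected (with_proj G)"
    and claw_free: "claw_free (with_proj G)"
    and subcubic: "subcubic (with_proj G)"
begin

text \<open>
  The invariant of the process: \<open>B\<close> is the initial blue set and \<open>N[J]\<close> the part forced so
  far. Recording the set \<open>J\<close> rather than the blue set keeps track of a dominating set of
  blue vertices that have no white neighbours.
\<close>

definition grown :: "'a set \<Rightarrow> 'a set \<Rightarrow> 'a set \<Rightarrow> bool" where
  "grown B J I \<longleftrightarrow> B \<subseteq> pverts G \<and> J \<noteq> {} \<and> J \<subseteq> pverts G \<and> forces B (closed_nbrs J) \<and>
     I \<subseteq> J \<and> independent_set (with_proj G) I"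

lemma grownD:
  assumes "grown B J I"
  shows "B \<subseteq> pverts G" "J \<noteq> {}" "J \<subseteq> pverts G" "forces B (closed_nbrs J)" "I \<subseteq> J"
    "independent_set (with_proj G) I" "finite B" "finite I" "closed_nbrs J \<subseteq> pverts G"
proof -
  show *: "B \<subseteq> pverts G" "J \<noteq> {}" "J \<subseteq> pverts G" "forces B (closed_nbrs J)" "I \<subseteq> J"
    "independent_set (with_proj G) I"
    using assms unfolding grown_def by auto
  show "finite B" "finite I"
    using * finite_subset[OF _ pair_finite_verts] by (meson subset_trans)+
  show "closed_nbrs J \<subseteq> pverts G"
    by (rule closed_nbrs_subset[OF *(3)])
qed

lemma outside_no_nbr:
  assumes "grown B J I" "w \<notin> closed_nbrs J"
  shows "nbrs w \<inter> I = {}" "w \<notin> I" "w \<notin> J"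
  using assms nbrs_sym[of w] unfolding grown_def closed_nbrs_def by blast+

lemma grown_insert_independent:
  assumes "grown B J I" "w \<in> pverts G" "w \<notin> closed_nbrs J"
  shows "independent_set (with_proj G) (insert w I)" "card (insert w I) = card I + 1"
  using assms outside_no_nbr[OF assms(1,3)] independent_set_insert grownD[OF assms(1)] by auto

lemma grown_force:
  assumes "grown B J I" "v \<in> closed_nbrs J" "card (nbrs v - closed_nbrs J) \<le> 1"
  shows "grown B (insert v J) I"
proof -
  have "forces B (closed_nbrs J \<union> nbrs v)"
    using grownD(4)[OF assms(1)] forces_nbrs[OF assms(2,3)] by (rule rtranclp_trans)
  moreover have "v \<in> pverts G"
    using grownD(9)[OF assms(1)] assms(2) by blast
  ultimately show ?thesis
    using assms(1) closed_nbrs_insert[OF assms(2)] unfolding grown_def by auto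
qed

text \<open>
  The neighbour \<open>u\<close> of \<open>v\<close> in \<open>J\<close> leaves room for two white neighbours only, and it is
  adjacent to neither of them, so they must be adjacent to each other to avoid a claw.
\<close>

lemma stalled_triangle:
  assumes gr: "grown B J I" and v: "v \<in> closed_nbrs J"
    and two: "card (nbrs v - closed_nbrs J) > 1"
  obtains a b where "a \<noteq> b" "nbrs v - closed_nbrs J = {a, b}" "b \<in> nbrs a"
proof -
  let ?S = "closed_nbrs J"
  have "v \<notin> J"
  proof
    assume "v \<in> J"
    then have "nbrs v - ?S = {}" unfolding closed_nbrs_def by blast
    then have "card (nbrs v - ?S) = 0" by (simp only: card.empty)
    then show False using two by linarith
  qed
  then obtain u where u: "u \<in> J" "u \<in> nbrs v"
    using v nbrs_sym unfolding closed_nbrs_def by auto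
  have uS: "u \<in> ?S" "nbrs u \<subseteq> ?S"
    using u unfolding closed_nbrs_def by auto
  have "nbrs v - ?S \<subseteq> nbrs v - {u}"
    using uS by blast
  then have "card (nbrs v - ?S) \<le> card (nbrs v - {u})"
    by (simp add: card_mono)
  then have "card (nbrs v - ?S) \<le> 2"
    using subcubic_card_nbrs[OF subcubic, of v] u by simp
  then have "card (nbrs v - ?S) = 2"
    using two by simp
  then obtain a b where ab: "nbrs v - ?S = {a, b}" "a \<noteq> b"
    by (meson card_2_iff)
  have "{u, a, b} \<subseteq> nbrs v" "card {u, a, b} = 3"
    using ab u uS by auto
  then have "a \<in> nbrs u \<or> b \<in> nbrs u \<or> b \<in> nbrs a"
    by (rule claw_free_nbrs[OF claw_free])
  moreover have "a \<notin> nbrs u" "b \<notin> nbrs u"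
    using ab(1) uS(2) by auto
  ultimately have "b \<in> nbrs a"
    by simp
  then show thesis using ab that[of a b] by simp
qed

text \<open>
  One further initial vertex buys one further independent vertex, namely \<open>a\<close> itself. It may
  enter \<open>J\<close> because \<open>v\<close> and \<open>b\<close> use up two of its at most three edges, so it can force
  its remaining neighbour.
\<close>

lemma grown_triangle:
  assumes gr: "grown B J I" and v: "v \<in> closed_nbrs J"
    and ab: "a \<noteq> b" "nbrs v - closed_nbrs J = {a, b}" "b \<in> nbrs a"
  shows "grown (insert a B) (insert a (insert v J)) (insert a I)"
    "card (insert a B) \<le> card B + 1" "card (insert a I) = card I + 1"
    "closed_nbrs (insert a (insert v J)) = closed_nbrs J \<union> {a, b} \<union> nbrs a"
    "card (nbrs a - {v, b}) \<le> 1"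
proof -
  let ?S = "closed_nbrs J"
  note grD = grownD[OF gr]
  have aV: "a \<in> pverts G" "a \<notin> ?S" "a \<in> nbrs v"
    using ab nbrs_subset by blast+
  have J1: "closed_nbrs (insert v J) = ?S \<union> {a, b}"
    using closed_nbrs_insert[OF v] ab by blast
  then show J2: "closed_nbrs (insert a (insert v J)) = closed_nbrs J \<union> {a, b} \<union> nbrs a"
    using closed_nbrs_insert[of a "insert v J"] by blast
  have "nbrs v - insert a ?S = {b}"
    using ab by blast
  then have f1: "forces (insert a ?S) (insert a ?S \<union> nbrs v)"
    using v by (intro forces_nbrs) auto
  have eq1: "insert a ?S \<union> nbrs v = ?S \<union> {a, b}"
    using ab by blast
  have vb: "{v, b} \<subseteq> nbrs a" "v \<noteq> b"
    using ab aV v nbrs_sym by blast+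
  then show c1: "card (nbrs a - {v, b}) \<le> 1"
    using subcubic_card_nbrs[OF subcubic, of a] by (simp add: card_Diff_subset)
  have "card (nbrs a - (?S \<union> {a, b})) \<le> card (nbrs a - {v, b})"
    using v by (intro card_mono) auto
  then have f2: "forces (?S \<union> {a, b}) (?S \<union> {a, b} \<union> nbrs a)"
    using c1 by (intro forces_nbrs) auto
  have "forces (insert a B) (?S \<union> {a, b} \<union> nbrs a)"
    using forces_insert[OF grD(4)] f1 f2 unfolding eq1 by (meson rtranclp_trans)
  moreover have "v \<in> pverts G"
    using v grD by blast
  ultimately show "grown (insert a B) (insert a (insert v J)) (insert a I)"
    using grD aV grown_insert_independent(1)[OF gr aV(1,2)]
    unfolding grown_def J2 by auto
  show "card (insert a I) = card I + 1"
    using grown_insert_independent(2)[OF gr aV(1,2)] .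
  show "card (insert a B) \<le> card B + 1"
    using grD by (simp add: card_insert_if)
qed

text \<open>
  Connectedness provides an edge from blue to white; either some force is possible, or the
  blue end of this edge spans a triangle with its two white neighbours.
\<close>

lemma grown_step_cases:
  assumes gr: "grown B J I" and ne: "closed_nbrs J \<noteq> pverts G"
  obtains (force) v w where "v \<in> closed_nbrs J" "nbrs v - closed_nbrs J = {w}"
    | (triangle) v a b where
      "\<And>x. x \<in> closed_nbrs J \<Longrightarrow> card (nbrs x - closed_nbrs J) \<noteq> 1"
      "v \<in> closed_nbrs J" "a \<noteq> b" "nbrs v - closed_nbrs J = {a, b}" "b \<in> nbrs a"
proof (cases "\<exists>x\<in>closed_nbrs J. card (nbrs x - closed_nbrs J) = 1")
  case True
  then show thesis using force by (metis card_1_singletonE)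
next
  case False
  have "closed_nbrs J \<subset> pverts G" "closed_nbrs J \<noteq> {}"
    using ne grownD[OF gr] unfolding closed_nbrs_def by blast+
  then obtain v w where v: "v \<in> closed_nbrs J" "w \<in> nbrs v" "w \<notin> closed_nbrs J"
    using boundary_edge[OF connected] by metis
  then have "card (nbrs v - closed_nbrs J) \<noteq> 0"
    by auto
  then have "card (nbrs v - closed_nbrs J) > 1"
    using False v(1) by (metis less_one linorder_neqE_nat)
  then show thesis
    using stalled_triangle[OF gr v(1)] triangle False v(1) by metis
qed

lemma grown_complete:
  assumes "grown B J I"
  shows "\<exists>B' J' I'. grown B' J' I' \<and> closed_nbrs J' = pverts G \<and>
    card B' + card I \<le> card B + card I'"
  using assms
proof (induction "card (pverts G - closed_nbrs J)" arbitrary: B J I rule: less_induct)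
  case less
  have smaller: "card (pverts G - closed_nbrs K) < card (pverts G - closed_nbrs J)"
    if "closed_nbrs J \<union> {w} \<subseteq> closed_nbrs K" "w \<in> pverts G" "w \<notin> closed_nbrs J" for K w
    using that pair_finite_verts by (intro psubset_card_mono) auto
  show ?case
  proof (cases "closed_nbrs J = pverts G")
    case True
    then show ?thesis using less.prems by blast
  next
    case False
    from less.prems False show ?thesis
    proof (cases rule: grown_step_cases)
      case (force v w)
      then have "grown B (insert v J) I"
        using grown_force[OF less.prems] by simp
      moreover have "closed_nbrs J \<union> {w} \<subseteq> closed_nbrs (insert v J)" "w \<in> pverts G"
        "w \<notin> closed_nbrs J"
        using force closed_nbrs_insert[OF force(1)] nbrs_subset by blast+
      ultimately show ?thesis using less.hyps smaller by blast
    next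
      case (triangle v a b)
      note gt = grown_triangle[OF less.prems triangle(2-)]
      have "closed_nbrs J \<union> {a} \<subseteq> closed_nbrs (insert a (insert v J))" "a \<in> pverts G"
        "a \<notin> closed_nbrs J"
        using triangle gt(4) nbrs_subset by blast+
      then obtain B' J' I' where g: "grown B' J' I'" "closed_nbrs J' = pverts G"
        and c: "card B' + card (insert a I) \<le> card (insert a B) + card I'"
        using less.hyps[OF smaller gt(1)] by blast
      have "card B' + card I \<le> card B + card I'"
        using c gt(2,3) by linarith
      then show ?thesis using g by blast
    qed
  qed
qed

text \<open>
  The gain comes from the step that makes the last vertices blue. If it is a single force, the
  forced vertex is white until then and joins \<open>I\<close> at no cost. If it is a triangle step, let
  \<open>c\<close> be the third neighbour of \<open>a\<close>. Then \<open>c\<close> is white too, and instead of \<open>a\<close> both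
  \<open>b\<close> and \<open>c\<close> join \<open>I\<close>; they are nonadjacent, since otherwise the edge \<open>a b\<close> would lie
  in the two triangles with \<open>v\<close> and \<open>c\<close>. The assumption that \<open>N[J]\<close> is not yet everything
  ensures that there is a last step.
\<close>

lemma grown_complete_gain:
  assumes cubic: "\<And>x. x \<in> pverts G \<Longrightarrow> card (nbrs x) = 3"
    and diamond_free: "\<And>x y p q. y \<in> nbrs x \<Longrightarrow> {p, q} \<subseteq> nbrs x \<inter> nbrs y \<Longrightarrow> p = q"
    and "grown B J I" "closed_nbrs J \<noteq> pverts G"
  shows "\<exists>B' I'. B' \<subseteq> pverts G \<and> forces B' (pverts G) \<and> independent_set (with_proj G) I' \<and>
    card B' + card I + 1 \<le> card B + card I'"
  using assms(3,4)
proof (induction "card (pverts G - closed_nbrs J)" arbitrary: B J I rule: less_induct)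
  case less
  let ?S = "closed_nbrs J"
  note gr = less.prems(1)
  have smaller: "card (pverts G - closed_nbrs K) < card (pverts G - closed_nbrs J)"
    if "closed_nbrs J \<union> {w} \<subseteq> closed_nbrs K" "w \<in> pverts G" "w \<notin> closed_nbrs J" for K w
    using that pair_finite_verts by (intro psubset_card_mono) auto
  from less.prems show ?case
  proof (cases rule: grown_step_cases)
    case (force v w)
    then have gr': "grown B (insert v J) I"
      using grown_force[OF gr] by simp
    have w: "closed_nbrs J \<union> {w} \<subseteq> closed_nbrs (insert v J)" "w \<in> pverts G" "w \<notin> ?S"
      using force closed_nbrs_insert[OF force(1)] nbrs_subset by blast+
    show ?thesis
    proof (cases "closed_nbrs (insert v J) = pverts G")
      case True
      then show ?thesis
        using grown_insert_independent[OF gr w(2,3)] grownD(1,4)[OF gr']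
        by (intro exI[of _ B] exI[of _ "insert w I"]) simp
    next
      case False
      then show ?thesis using less.hyps[OF smaller[OF w] gr'] by blast
    qed
  next
    case (triangle v a b)
    note gt = grown_triangle[OF gr triangle(2-)]
    have a: "closed_nbrs J \<union> {a} \<subseteq> closed_nbrs (insert a (insert v J))" "a \<in> pverts G"
      "a \<notin> ?S" and b: "b \<in> pverts G" "b \<notin> ?S" and v: "v \<in> nbrs a" "b \<in> nbrs v" "a \<in> nbrs v"
      using triangle gt(4) nbrs_subset nbrs_sym by blast+
    show ?thesis
    proof (cases "closed_nbrs (insert a (insert v J)) = pverts G")
      case False
      then obtain B' I' where g: "B' \<subseteq> pverts G" "forces B' (pverts G)"
        "independent_set (with_proj G) I'"
        and c: "card B' + card (insert a I) + 1 \<le> card (insert a B) + card I'"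
        using less.hyps[OF smaller[OF a] gt(1)] by blast
      have "card B' + card I + 1 \<le> card B + card I'"
        using c gt(2,3) by linarith
      then show ?thesis using g by blast
    next
      case True
      have "v \<noteq> b" using triangle b by blast
      then have "card (nbrs a - {v, b}) = 1"
        using v triangle cubic[OF a(2)] by (simp add: card_Diff_subset)
      then obtain c where c: "nbrs a - {v, b} = {c}"
        by (rule card_1_singletonE)
      have cb: "c \<notin> nbrs b"
      proof
        assume "c \<in> nbrs b"
        then have "{v, c} \<subseteq> nbrs a \<inter> nbrs b"
          using c v nbrs_sym by blast
        then show False using diamond_free[OF triangle(5)] c by blast
      qed
      \<comment> \<open>If \<open>c\<close> were blue, it would have a second white neighbour \<open>f\<close>, adjacent to \<open>a\<close>;
        the only candidate is \<open>b\<close>.\<close>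
      have cS: "c \<notin> ?S"
      proof
        assume cS: "c \<in> ?S"
        have ac: "a \<in> nbrs c - ?S"
          using c a nbrs_sym by blast
        then have "card (nbrs c - ?S) \<noteq> 0"
          by auto
        then have "card (nbrs c - ?S) > 1"
          using triangle(1)[OF cS] by linarith
        then obtain d e where de: "nbrs c - ?S = {d, e}" "e \<in> nbrs d"
          using stalled_triangle[OF gr cS] by metis
        define f where "f = (if a = d then e else d)"
        have f: "f \<in> nbrs a" "f \<in> nbrs c" "f \<notin> ?S"
          using de ac nbrs_sym unfolding f_def by auto
        have "f \<in> {v, b, c}"
          using f(1) c by blast
        moreover have "f \<noteq> v" "f \<noteq> c"
          using f(3) cS triangle(2) by metis+
        ultimately have "b \<in> nbrs c"
          using f(2) by simp
        then show False using cb nbrs_sym[of b c] by simp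
      qed
      have ind: "independent_set (with_proj G) (insert b I)" "card (insert b I) = card I + 1"
        using grown_insert_independent[OF gr b] .
      have cV: "c \<in> pverts G" using c nbrs_subset by blast
      have "nbrs c \<inter> insert b I = {}" "c \<noteq> b" "c \<notin> I"
        using outside_no_nbr[OF gr cS] cb c nbrs_sym[of b c] by auto
      then have "independent_set (with_proj G) (insert c (insert b I))"
        "card (insert c (insert b I)) = card I + 2"
        using independent_set_insert[OF ind(1) cV] ind(2) grownD[OF gr] by auto
      moreover have "insert a B \<subseteq> pverts G" "forces (insert a B) (pverts G)"
        using grownD(1,4)[OF gt(1)] True by simp_all
      ultimately show ?thesis
        using gt(2) by (intro exI[of _ "insert a B"] exI[of _ "insert c (insert b I)"]) simp
    qed
  qed
qed

lemma bound_if_grown: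
  assumes "grown B J I" "card B \<le> card I + 1"
  shows "zero_forcing_number (with_proj G) \<le> independence_number (with_proj G) + 1"
proof -
  obtain B' J' I' where g: "grown B' J' I'" "closed_nbrs J' = pverts G"
    and c: "card B' + card I \<le> card B + card I'"
    using grown_complete[OF assms(1)] by blast
  have "forces B' (pverts G)" using grownD(4)[OF g(1)] g(2) by simp
  then show ?thesis
    using grownD(1,6)[OF g(1)] c assms(2) by (intro forces_all_bound[of B' I']) auto
qed

section \<open>Where to start\<close>

lemma bound_if_degree_le_2:
  assumes "x \<in> pverts G" "card (nbrs x) \<le> 2"
  shows "zero_forcing_number (with_proj G) \<le> independence_number (with_proj G) + 1"
proof -
  \<comment> \<open>\<open>A\<close> holds one neighbour of \<open>x\<close>, or none if \<open>x\<close> is isolated.\<close>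
  obtain A where A: "A \<subseteq> nbrs x" "card A \<le> 1" "card (nbrs x - A) \<le> 1"
  proof (cases "nbrs x = {}")
    case True
    then show thesis using that by auto
  next
    case False
    then obtain y where "y \<in> nbrs x" by blast
    then show thesis using that[of "{y}"] assms(2) by simp
  qed
  have "nbrs x - insert x A = nbrs x - A"
    by auto
  then have "forces (insert x A) (insert x A \<union> nbrs x)"
    using A by (intro forces_nbrs) auto
  moreover have "insert x A \<union> nbrs x = closed_nbrs {x}"
    using A unfolding closed_nbrs_def by blast
  ultimately have "grown (insert x A) {x} {x}"
    using assms A nbrs_subset[of x] unfolding grown_def independent_set_iff by auto
  moreover have "card (insert x A) \<le> 2"
    using A(2) finite_subset[OF A(1)] by (simp add: card_insert_if)
  ultimately show ?thesis
    by (intro bound_if_grown) auto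
qed

text \<open>
  Colouring \<open>x\<close>, \<open>y\<close>, \<open>p\<close> lets \<open>x\<close> force \<open>q\<close>, after which \<open>p\<close> and \<open>q\<close> have at most
  one white neighbour each. If \<open>p\<close> and \<open>q\<close> were adjacent, the four vertices would have no
  further neighbours, so that the connected graph would be \<open>K\<^sub>4\<close>.
\<close>

lemma bound_if_diamond:
  assumes "\<not> complete_digraph 4 (with_proj G)"
    and xy: "y \<in> nbrs x" and pq: "{p, q} \<subseteq> nbrs x \<inter> nbrs y" "p \<noteq> q"
  shows "zero_forcing_number (with_proj G) \<le> independence_number (with_proj G) + 1"
proof -
  have ne: "x \<noteq> y" "x \<noteq> p" "x \<noteq> q" "y \<noteq> p" "y \<noteq> q"
    using assms not_self_nbr by blast+
  have full: "nbrs v = W" if "W \<subseteq> nbrs v" "card W = 3" for v W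
    using card_seteq[of "nbrs v" W] that subcubic_card_nbrs[OF subcubic, of v] by simp
  have Nx: "nbrs x = {y, p, q}"
    by (rule full) (use xy pq ne in auto)
  have Ny: "nbrs y = {x, p, q}"
    by (rule full) (use xy pq ne nbrs_sym[of x y] in auto)
  have V: "{x, y, p, q} \<subseteq> pverts G"
    using Nx Ny nbrs_subset by blast
  have npq: "q \<notin> nbrs p"
  proof
    assume adj: "q \<in> nbrs p"
    have Np: "nbrs p = {x, y, q}"
      by (rule full) (use adj pq ne nbrs_sym[of p x] nbrs_sym[of p y] in auto)
    have Nq: "nbrs q = {x, y, p}"
      by (rule full) (use adj pq ne nbrs_sym[of q] in auto)
    have W: "pverts G = {x, y, p, q}"
    proof (rule ccontr)
      assume "pverts G \<noteq> {x, y, p, q}"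
      then have "{x, y, p, q} \<subset> pverts G" using V by blast
      then obtain v w where "v \<in> {x, y, p, q}" "w \<in> nbrs v" "w \<notin> {x, y, p, q}"
        using boundary_edge[OF connected, of "{x, y, p, q}"] by blast
      then show False using Nx Ny Np Nq by auto
    qed
    have "(u, v) \<in> parcs G \<longleftrightarrow> u \<in> pverts G \<and> v \<in> pverts G \<and> u \<noteq> v" for u v
    proof (cases "u \<in> pverts G")
      case True
      then have "v \<in> nbrs u \<longleftrightarrow> v \<in> pverts G \<and> u \<noteq> v"
        unfolding W using Nx Ny Np Nq ne pq(2) by auto
      then show ?thesis using True by (simp add: nbrs_def)
    next
      case False
      then show ?thesis using in_arcsD1 by blast
    qed
    then have "parcs G = {(u, v). (u, v) \<in> pverts G \<times> pverts G \<and> u \<noteq> v}"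
      by auto
    moreover have "card (pverts G) = 4"
      unfolding W using ne pq(2) by simp
    ultimately have "complete_digraph 4 (with_proj G)"
      unfolding complete_digraph_pair_def using pair_finite_verts by blast
    then show False using assms(1) by simp
  qed
  let ?B = "{x, y, p}"
  have xyN: "{x, y} \<subseteq> nbrs p" "{x, y} \<subseteq> nbrs q"
    using Nx Ny nbrs_sym[of x] nbrs_sym[of y] by auto
  have le1: "card (nbrs v - {x, y}) \<le> 1" if "{x, y} \<subseteq> nbrs v" for v
    using that ne subcubic_card_nbrs[OF subcubic, of v] by (simp add: card_Diff_subset)
  have "nbrs x - ?B = {q}"
    using Nx ne pq(2) by blast
  then have f1: "forces ?B (?B \<union> nbrs x)"
    by (intro forces_nbrs) auto
  have eq1: "?B \<union> nbrs x = {x, y, p, q}"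
    using Nx by blast
  have "card (nbrs p - {x, y, p, q}) \<le> card (nbrs p - {x, y})"
    by (intro card_mono) auto
  then have f2: "forces {x, y, p, q} ({x, y, p, q} \<union> nbrs p)"
    using le1[OF xyN(1)] by (intro forces_nbrs) auto
  have "card (nbrs q - ({x, y, p, q} \<union> nbrs p)) \<le> card (nbrs q - {x, y})"
    by (intro card_mono) auto
  then have f3: "forces ({x, y, p, q} \<union> nbrs p) ({x, y, p, q} \<union> nbrs p \<union> nbrs q)"
    using le1[OF xyN(2)] by (intro forces_nbrs) auto
  have eq3: "{x, y, p, q} \<union> nbrs p \<union> nbrs q = closed_nbrs {p, q}"
    using xyN unfolding closed_nbrs_def by auto
  have "forces ?B (closed_nbrs {p, q})"
    using f1 f2 f3 unfolding eq1 eq3 by (meson rtranclp_trans)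
  then have "grown ?B {p, q} {p, q}"
    using V npq nbrs_sym[of p q] unfolding grown_def independent_set_iff by auto
  then show ?thesis
    by (rule bound_if_grown) (use pq(2) ne in auto)
qed

text \<open>
  The start is a triangle \<open>x y z\<close>, whose vertex \<open>x\<close> forces its third neighbour \<open>p\<close>. The
  edge \<open>x y\<close> lies in no second triangle, so the third neighbour of \<open>y\<close> is still white and
  the gain of the last step is available.
\<close>

lemma bound_if_cubic_diamond_free:
  assumes cubic: "\<And>x. x \<in> pverts G \<Longrightarrow> card (nbrs x) = 3"
    and diamond_free: "\<And>x y p q. y \<in> nbrs x \<Longrightarrow> {p, q} \<subseteq> nbrs x \<inter> nbrs y \<Longrightarrow> p = q"
  shows "zero_forcing_number (with_proj G) \<le> independence_number (with_proj G) + 1"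
proof -
  obtain x where x: "x \<in> pverts G"
    using connected symmetric_connected_imp_strongly_connected pair_sym_arcs
    unfolding strongly_connected_def by auto
  obtain y z p where yzp: "nbrs x = {y, z, p}" "y \<noteq> z" "y \<noteq> p" "z \<noteq> p" "z \<in> nbrs y"
  proof -
    obtain r s t where rst: "nbrs x = {r, s, t}" "r \<noteq> s" "r \<noteq> t" "s \<noteq> t"
      using cubic[OF x] unfolding card_3_iff by blast
    then have "s \<in> nbrs r \<or> t \<in> nbrs r \<or> t \<in> nbrs s"
      using claw_free_nbrs[OF claw_free, of r s t x] by simp
    then show thesis
      using that[of r s t] that[of r t s] that[of s t r] rst by blast
  qed
  have py: "p \<notin> nbrs y"
    using diamond_free[of y x z p] yzp by blast
  let ?B = "{x, y, z}"
  have "nbrs x - ?B = {p}"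
    using yzp not_self_nbr[of x] by blast
  then have "forces ?B (?B \<union> nbrs x)"
    by (intro forces_nbrs) auto
  moreover have S: "?B \<union> nbrs x = closed_nbrs {x}"
    unfolding closed_nbrs_def by (simp add: yzp(1) insert_commute)
  moreover have "?B \<subseteq> pverts G"
    using x yzp(1) nbrs_subset[of x] by simp
  ultimately have gr: "grown ?B {x} {x}"
    using x unfolding grown_def independent_set_iff by simp
  have "closed_nbrs {x} \<noteq> pverts G"
  proof
    assume "closed_nbrs {x} = pverts G"
    then have "pverts G = {x, y, z} \<union> {y, z, p}"
      unfolding S[symmetric] yzp(1) by simp
    then have "nbrs y \<subseteq> {x, z}"
      using py nbrs_subset[of y] not_self_nbr[of y] by fast
    then have "card (nbrs y) \<le> card {x, z}"
      by (intro card_mono) auto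
    moreover have "card {x, z} \<le> 2"
      by (simp add: card_insert_if)
    moreover have "card (nbrs y) = 3"
      using cubic yzp(1) nbrs_subset[of x] by blast
    ultimately show False by simp
  qed
  from grown_complete_gain[OF _ _ gr this]
  have "\<exists>B' I'. B' \<subseteq> pverts G \<and> forces B' (pverts G) \<and> independent_set (with_proj G) I' \<and>
      card B' + card {x} + 1 \<le> card ?B + card I'"
    using cubic diamond_free by metis
  then obtain B' I' where B': "B' \<subseteq> pverts G" "forces B' (pverts G)"
    "independent_set (with_proj G) I'" "card B' + card {x} + 1 \<le> card ?B + card I'"
    by blast
  have "card ?B \<le> 3"
    by (simp add: card_insert_if)
  then show ?thesis
    using forces_all_bound[OF B'(1-3)] B'(4) by simp
qed

end

theorem theorem19:
  fixes G :: "'a pair_pre_digraph"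
  assumes "pair_graph G"
    and "\<not> complete_digraph 4 (with_proj G)"
    and "Digraph_Component.connected (with_proj G)"
    and "claw_free (with_proj G)"
    and "subcubic (with_proj G)"
  shows "zero_forcing_number (with_proj G) \<le> independence_number (with_proj G) + 1"
proof -
  interpret pair_graph G by (rule assms(1))
  interpret claw_free_subcubic_graph G
    by unfold_locales (use assms in auto)
  consider (low) x where "x \<in> pverts G" "card (nbrs x) \<le> 2"
    | (diamond) x y p q where "y \<in> nbrs x" "{p, q} \<subseteq> nbrs x \<inter> nbrs y" "p \<noteq> q"
    | (rest) "\<And>x. x \<in> pverts G \<Longrightarrow> card (nbrs x) = 3"
        "\<And>x y p q. y \<in> nbrs x \<Longrightarrow> {p, q} \<subseteq> nbrs x \<inter> nbrs y \<Longrightarrow> p = q"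
    using subcubic_card_nbrs[OF assms(5)]
    by (metis le_antisym not_less_eq_eq numeral_2_eq_2 numeral_3_eq_3)
  then show ?thesis
  proof cases
    case low
    then show ?thesis by (rule bound_if_degree_le_2)
  next
    case diamond
    then show ?thesis by (rule bound_if_diamond[OF assms(2)])
  next
    case rest
    show ?thesis
      by (rule bound_if_cubic_diamond_free) (erule rest(1), erule (1) rest(2))
  qed
qed

end
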